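(* Let $A\in S_+(\mathbb{R}^n)$ and let $\hat A$ be a random matrix with $\hat A\in S_+(\mathbb{R}^n)$ almost surely, $\mathbb{E}[\hat A]\preceq A$ (in particular this covers $\mathbb{E}[\hat A]=A$), and $\mathbb{E}[\hat A^{-2}]$ finite. Let $B\in S_+(\mathbb{R}^n)$, let $R\in\mathbb{R}^{n\times n}$ be symmetric positive semi-definite, and let $C,D\in\mathbb{R}^{n\times n}$ satisfy the compatibility conditions $$R D^T = C^T B,\qquad R D^T=(R D^T)^T,\qquad R D^T\succeq 0 .$$ Let $\hat K = C\hat A^{-1}D$, and assume $\mathbb{E}\|\hat A^{-1}\|^2_{C^TBC,\,DRD^T}>0$. Let $\beta^*=\operatorname{arg\,min}_{\beta\in\mathbb{R}}\mathcal{E}_{B,R}(\hat A^{-1}-\beta\hat K)$. Then $$\sqrt{\frac{\mathcal{E}_{B,R}(\hat A^{-1})}{\mathbb{E}\|\hat A^{-1}\|^2_{C^TBC,\,DRD^T}}}\;\ge\;\beta^*\;\ge\;\frac{\mathcal{E}_{C^TB,\,RD^T}(\hat A^{-1})}{\mathbb{E}\|\hat A^{-1}\|^2_{C^TBC,\,DRD^T}}\;\ge\;0 .$$ Moreover, if $\mathcal{E}_{B,R}(\hat A^{-1})>0$, then $$\max_{\beta\in\mathbb{R}}\frac{\mathcal{E}_{B,R}(\hat A^{-1})-\mathcal{E}_{B,R}(\hat A^{-1}-\beta\hat K)}{\mathcal{E}_{B,R}(\hat A^{-1})}\;\ge\;\frac{\mathcal{E}_{C^TB,\,RD^T}(\hat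 A^{-1})^2}{\mathbb{E}\|\hat A^{-1}\|^2_{C^TBC,\,DRD^T}\;\mathcal{E}_{B,R}(\hat A^{-1})} .$$
   Context: $S_+(\mathbb{R}^n)$ is the set of symmetric positive definite $n\times n$ real matrices; $\preceq$ is the Loewner order. For symmetric positive semi-definite $P,Q\in\mathbb{R}^{n\times n}$ and $X,Y\in\mathbb{R}^{n\times n}$, define $\langle X,Y\rangle_{P,Q}=\operatorname{tr}(Q^{1/2}X^TPYQ^{1/2})$ and $\|X\|_{P,Q}^2=\langle X,X\rangle_{P,Q}$. For a random matrix $\hat X$ regarded as an estimator of $A^{-1}$, define the mean squared error $\mathcal{E}_{P,Q}(\hat X)=\mathbb{E}\|\hat X-A^{-1}\|_{P,Q}^2$. (In the paper $R=\mathbb{E}[bb^T]$ is the second moment matrix of a distribution of right-hand sides $b$.) *)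

theory Defs
  imports "HOL-Probability.Probability"
begin

definition pos_semidef :: "real^'n^'n \<Rightarrow> bool" where
  "pos_semidef P \<longleftrightarrow> transpose P = P \<and> (\<forall>x. 0 \<le> x \<bullet> (P *v x))"

definition pos_def :: "real^'n^'n \<Rightarrow> bool" where
  "pos_def P \<longleftrightarrow> transpose P = P \<and> (\<forall>x. x \<noteq> 0 \<longrightarrow> 0 < x \<bullet> (P *v x))"

definition loewner_le :: "real^'n^'n \<Rightarrow> real^'n^'n \<Rightarrow> bool" (infix "\<preceq>\<^sub>L" 50) where
  "X \<preceq>\<^sub>L Y \<longleftrightarrow> pos_semidef (Y - X)"

text \<open>The square root \<open>Q\<^sup>1\<^sup>/\<^sup>2\<close>: the unique positive semi-definite root.
  Only meaningful for positive semi-definite \<open>Q\<close>.\<close>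

definition mat_sqrt :: "real^'n^'n \<Rightarrow> real^'n^'n" where
  "mat_sqrt Q = (THE S. pos_semidef S \<and> S ** S = Q)"

definition weighted_inner ::
    "real^'n^'n \<Rightarrow> real^'n^'n \<Rightarrow> real^'n^'n \<Rightarrow> real^'n^'n \<Rightarrow> real" where
  "weighted_inner P Q X Y =
     trace (mat_sqrt Q ** transpose X ** P ** Y ** mat_sqrt Q)"

text \<open>This is the \<^emph>\<open>squared\<close> norm \<open>\<parallel>X\<parallel>\<^sup>2\<close>.\<close>

definition weighted_norm_sq :: "real^'n^'n \<Rightarrow> real^'n^'n \<Rightarrow> real^'n^'n \<Rightarrow> real" where
  "weighted_norm_sq P Q X = weighted_inner P Q X X"

text \<open>The estimator \<open>X\<close> is a random matrix over \<open>M\<close>; the estimated quantity is the inverse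
  of \<open>A\<close>, not \<open>A\<close> itself.\<close>

definition mean_sq_error ::
    "'w measure \<Rightarrow> real^'n^'n \<Rightarrow> real^'n^'n \<Rightarrow> real^'n^'n \<Rightarrow> ('w \<Rightarrow> real^'n^'n) \<Rightarrow> real" where
  "mean_sq_error M A P Q X =
     (\<integral>\<omega>. weighted_norm_sq P Q (X \<omega> - matrix_inv A) \<partial>M)"

end

theory Submission imports Defs begin

text \<open>Write \<open>X\<close> for the inverse of the random matrix, \<open>X\<^sub>0 = A\<inverse>\<close> and \<open>S = R D\<^sup>T = C\<^sup>T B\<close>. The
  compatibility conditions give \<open>B C = D R = S\<close>, so that
  \<open>\<langle>X - X\<^sub>0, C X D\<rangle>\<close> in the \<open>(B, R)\<close>-product equals \<open>\<langle>X - X\<^sub>0, X\<rangle>\<close> in the \<open>(S, S)\<close>-product. The error is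
  therefore the parabola \<open>e\<^sub>0 - 2 \<beta> a + \<beta>\<^sup>2 N\<close> with
  \<open>a = E\<langle>X - X\<^sub>0, X\<rangle>\<close>, and its minimiser is \<open>a / N\<close>. Its minimum is nonnegative, which bounds \<open>a / N\<close>
  from above. The difference of \<open>a\<close> and the \<open>(S, S)\<close>-error is \<open>tr ((E[X] - X\<^sub>0) S X\<^sub>0 S)\<close>, which is
  nonnegative because \<open>E[X] \<succeq> X\<^sub>0\<close> by operator convexity of the inversion; this bounds \<open>a / N\<close> from
  below. The spectral theorem enters only through existence and uniqueness of
  \<open>Q\<^sup>1\<^sup>/\<^sup>2\<close>.\<close>

section \<open>Spectral theorem for self-adjoint maps\<close>

text \<open>A maximiser \<open>e\<close> of the Rayleigh quotient on the compact unit sphere of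
  \<open>V\<close> is an eigenvector: a nonzero residual \<open>f e - c e\<close> lies in
  \<open>V\<close> by invariance, and moving \<open>e\<close> along it would raise the quotient to
  first order.\<close>

lemma self_adjoint_eigenvector:
  fixes f :: "'a::euclidean_space \<Rightarrow> 'a"
  assumes "linear f" and sa: "\<And>x y. x \<bullet> f y = f x \<bullet> y"
    and "subspace V" and "V \<noteq> {0}" and inv: "f ` V \<subseteq> V"
  obtains e where "e \<in> V" "norm e = 1" "f e = (e \<bullet> f e) *\<^sub>R e"
proof -
  interpret f: linear f by fact
  obtain v where v: "v \<in> V" "v \<noteq> 0"
    using assms(3,4) subspace_0 by blast
  have "compact (sphere 0 1 \<inter> V)"
    using assms(3) by (simp add: closed_subspace compact_Int_closed)
  moreover have "sgn v \<in> sphere 0 1 \<inter> V"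
    using v assms(3) by (simp add: norm_sgn sgn_div_norm subspace_scale)
  moreover have "continuous_on (sphere 0 1 \<inter> V) (\<lambda>x. x \<bullet> f x)"
    by (intro continuous_intros linear_continuous_on linear_conv_bounded_linear[THEN iffD1] assms(1))
  ultimately obtain e where e: "e \<in> V" "norm e = 1"
      and max: "\<And>x. x \<in> V \<Longrightarrow> norm x = 1 \<Longrightarrow> x \<bullet> f x \<le> e \<bullet> f e"
    using continuous_attains_sup[of "sphere 0 1 \<inter> V" "\<lambda>x. x \<bullet> f x"]
    by (metis IntD1 IntD2 IntI empty_iff mem_sphere_0)
  define c where "c = e \<bullet> f e"
  have bound: "x \<bullet> f x \<le> c * (x \<bullet> x)" if "x \<in> V" for x
  proof (cases "x = 0")
    case False
    have "sgn x \<bullet> f (sgn x) \<le> c"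
      unfolding c_def using that False assms(3)
      by (intro max) (simp_all add: norm_sgn sgn_div_norm subspace_scale)
    then have "(x \<bullet> f x) / (norm x)\<^sup>2 \<le> c"
      by (simp add: sgn_div_norm f.scaleR power2_eq_square divide_inverse mult_ac)
    then show ?thesis
      using False by (simp add: field_simps dot_square_norm)
  qed (simp add: f.zero)
  define r where "r = f e - c *\<^sub>R e"
  have "r \<in> V"
    unfolding r_def using e inv assms(3) by (intro subspace_diff subspace_scale) auto
  have re: "r \<bullet> e = 0"
    using e(2) by (simp add: r_def c_def inner_diff_left inner_commute[of "f e"] dot_square_norm)
  have rfe: "r \<bullet> f e = r \<bullet> r"
  proof -
    have "r \<bullet> (r + c *\<^sub>R e) = r \<bullet> r"
      using re by (simp add: inner_add_right)
    then show ?thesis by (simp add: r_def)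
  qed
  have "e \<bullet> f r = r \<bullet> r"
    using rfe sa[of e r] by (simp add: inner_commute)
  define K where "K = c * (r \<bullet> r) - r \<bullet> f r"
  \<comment> \<open>Comparing at \<open>e + t r\<close>: the first-order gain
    \<open>2 * t * (r \<bullet> r)\<close> cannot exceed the second-order term
    \<open>t * t * K\<close>.\<close>
  have "2 * (r \<bullet> r) \<le> t * K" if "t > 0" for t
  proof -
    have "(e + t *\<^sub>R r) \<bullet> f (e + t *\<^sub>R r) \<le> c * ((e + t *\<^sub>R r) \<bullet> (e + t *\<^sub>R r))"
      using e \<open>r \<in> V\<close> assms(3) by (intro bound subspace_add subspace_scale) auto
    then have "t * (2 * (r \<bullet> r)) \<le> t * (t * K)"
      using re rfe \<open>e \<bullet> f r = r \<bullet> r\<close> e(2)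
      by (simp add: f.add f.scaleR inner_add_left inner_add_right inner_commute[of e r]
          dot_square_norm[of e] K_def algebra_simps flip: c_def)
    then show ?thesis using that by simp
  qed
  \<comment> \<open>The step \<open>t = (r \<bullet> r) / (\<bar>K\<bar> + 1)\<close> is small
    enough that \<open>t * K\<close> is at most \<open>r \<bullet> r\<close>, which contradicts the
    lower bound \<open>2 * (r \<bullet> r)\<close> unless \<open>r = 0\<close>.\<close>
  then have "2 * (r \<bullet> r) \<le> (r \<bullet> r) / (\<bar>K\<bar> + 1) * K" if "r \<noteq> 0"
    using that by (metis abs_ge_zero add_nonneg_pos divide_pos_pos inner_gt_zero_iff zero_less_one)
  moreover have "(r \<bullet> r) / (\<bar>K\<bar> + 1) * K \<le> r \<bullet> r"
    by (simp add: divide_le_eq mult_left_mono)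
  ultimately have "r = 0"
    by (metis inner_gt_zero_iff leD mult_2 less_add_same_cancel1 order.trans)
  then show thesis
    using that e by (simp add: r_def c_def)
qed

text \<open>An orthonormal set of eigenvectors of greatest cardinality spans: otherwise its
  orthogonal complement is a nonzero invariant subspace and contains one more eigenvector.\<close>

lemma self_adjoint_eigenbasis:
  fixes f :: "'a::euclidean_space \<Rightarrow> 'a"
  assumes "linear f" and sa: "\<And>x y. x \<bullet> f y = f x \<bullet> y"
  obtains E where "finite E" "pairwise orthogonal E" "\<And>e. e \<in> E \<Longrightarrow> norm e = 1"
    "\<And>e. e \<in> E \<Longrightarrow> f e = (e \<bullet> f e) *\<^sub>R e" "span E = UNIV"
proof -
  define Good where "Good E \<longleftrightarrow> pairwise orthogonal E \<and>
    (\<forall>e\<in>E. norm e = 1 \<and> f e = (e \<bullet> f e) *\<^sub>R e)" for E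
  \<comment> \<open>Orthonormal sets are independent, so the dimension bounds their cardinality and
    a greatest one exists.\<close>
  have fin: "finite E \<and> card E \<le> DIM('a)" if "Good E" for E
  proof -
    have "0 \<notin> E" using that by (force simp: Good_def)
    then show ?thesis
      using that pairwise_orthogonal_independent independent_bound unfolding Good_def by blast
  qed
  have "Good {}" by (simp add: Good_def)
  moreover have "\<forall>F. Good F \<longrightarrow> card F < Suc DIM('a)"
    using fin by (simp add: less_Suc_eq_le)
  ultimately have "\<exists>E. Good E \<and> (\<forall>F. Good F \<longrightarrow> card F \<le> card E)"
    by (rule ex_has_greatest_nat)
  then obtain E where E: "Good E" and max: "\<And>F. Good F \<Longrightarrow> card F \<le> card E"
    by blast
  have "span E = UNIV"
  proof (rule ccontr)
    assume "span E \<noteq> UNIV"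
    then have "span E \<subset> span UNIV" by auto
    then obtain x where x: "x \<noteq> 0" "\<And>y. y \<in> span E \<Longrightarrow> orthogonal x y"
      using orthogonal_to_subspace_exists_gen by blast
    define V where "V = {x. \<forall>e\<in>E. orthogonal e x}"
    have "subspace V"
      by (auto simp: V_def subspace_def orthogonal_def inner_add_right)
    moreover have "V \<noteq> {0}"
    proof -
      have "x \<in> V"
        using x(2) by (simp add: V_def orthogonal_commute span_base)
      with x(1) show ?thesis by blast
    qed
    moreover have "f ` V \<subseteq> V"
    proof (clarsimp simp: V_def)
      fix x e assume "\<forall>e\<in>E. orthogonal e x" "e \<in> E"
      moreover have "f e = (e \<bullet> f e) *\<^sub>R e"
        using E \<open>e \<in> E\<close> by (simp add: Good_def)
      ultimately show "orthogonal e (f x)"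
        unfolding orthogonal_def sa by (metis inner_scaleR_left mult_zero_right)
    qed
    ultimately obtain e where e: "e \<in> V" "norm e = 1" "f e = (e \<bullet> f e) *\<^sub>R e"
      using self_adjoint_eigenvector[OF assms] by metis
    then have "e \<notin> E"
      by (auto simp: V_def orthogonal_def)
    moreover have "Good (insert e E)"
      using E e by (auto simp: Good_def V_def pairwise_insert orthogonal_commute)
    ultimately show False
      using max[of "insert e E"] fin[OF E] by simp
  qed
  then show thesis
    using that E fin[OF E] unfolding Good_def by blast
qed

section \<open>Square roots of positive semi-definite matrices\<close>

lemma symmetric_matrix_iff:
  fixes P :: "real^'n^'n"
  shows "transpose P = P \<longleftrightarrow> (\<forall>x y. x \<bullet> (P *v y) = (P *v x) \<bullet> y)"
proof
  assume "transpose P = P"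
  then show "\<forall>x y. x \<bullet> (P *v y) = (P *v x) \<bullet> y"
    by (metis dot_lmul_matrix transpose_matrix_vector)
next
  assume *: "\<forall>x y. x \<bullet> (P *v y) = (P *v x) \<bullet> y"
  have "transpose P *v x = P *v x" for x
    by (rule vector_eq_rdot[THEN iffD1])
      (metis * dot_lmul_matrix vector_transpose_matrix matrix_transpose_mul transpose_matrix_vector)
  then show "transpose P = P" by (simp add: matrix_eq)
qed

lemma pos_semidef_sqrt_exists:
  fixes Q :: "real^'n^'n"
  assumes "pos_semidef Q"
  obtains S where "pos_semidef S" "S ** S = Q"
proof -
  have sa: "\<And>x y. x \<bullet> (Q *v y) = (Q *v x) \<bullet> y" and nn: "\<And>x. 0 \<le> x \<bullet> (Q *v x)"
    using assms by (auto simp: pos_semidef_def symmetric_matrix_iff)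
  obtain E where E: "finite E" "pairwise orthogonal E" "\<And>e. e \<in> E \<Longrightarrow> norm e = 1"
    "\<And>e. e \<in> E \<Longrightarrow> Q *v e = (e \<bullet> (Q *v e)) *\<^sub>R e" "span E = UNIV"
    using self_adjoint_eigenbasis[OF matrix_vector_mul_linear sa] by blast
  \<comment> \<open>In the orthonormal eigenbasis of \<open>Q\<close>, the map \<open>g\<close>
    replaces each eigenvalue \<open>e \<bullet> (Q *v e)\<close> by its square root.\<close>
  define g where "g x = (\<Sum>e\<in>E. (sqrt (e \<bullet> (Q *v e)) * (e \<bullet> x)) *\<^sub>R e)" for x
  have lin: "linear g"
    by (auto intro!: linearI simp: g_def inner_add_right algebra_simps sum.distrib scaleR_sum_right)
  have gE: "g e = sqrt (e \<bullet> (Q *v e)) *\<^sub>R e" if "e \<in> E" for e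
  proof -
    have "g e = (\<Sum>d\<in>E. if d = e then sqrt (e \<bullet> (Q *v e)) *\<^sub>R e else 0)"
      unfolding g_def using E(2,3) that
      by (intro sum.cong) (auto simp: pairwise_def orthogonal_def dot_square_norm)
    then show ?thesis using that E(1) by simp
  qed
  have S: "matrix g *v x = g x" for x
    using lin by (simp add: matrix_works)
  have "g (g x) = Q *v x" for x
  proof (rule linear_eq_on_span[where B = E and f = "\<lambda>x. g (g x)"])
    show "linear (\<lambda>x. g (g x))"
      using linear_compose[OF lin lin] by (simp add: o_def)
    show "linear ((*v) Q)" by simp
    show "x \<in> span E" by (simp add: E)
    fix e assume "e \<in> E"
    then show "g (g e) = Q *v e"
      using gE linear_cmul[OF lin] E(4)[of e] nn[of e] by (metis real_sqrt_mult_self abs_of_nonneg scaleR_scaleR)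
  qed
  then have "matrix g ** matrix g = Q"
    by (simp add: matrix_eq S flip: matrix_vector_mul_assoc)
  moreover have "pos_semidef (matrix g)"
    unfolding pos_semidef_def symmetric_matrix_iff S
  proof (intro conjI allI)
    fix x y
    show "x \<bullet> g y = g x \<bullet> y"
      by (simp add: g_def inner_sum_left inner_sum_right inner_commute[of x] mult_ac)
    have "x \<bullet> g x = (\<Sum>e\<in>E. sqrt (e \<bullet> (Q *v e)) * (e \<bullet> x)\<^sup>2)"
      by (simp add: g_def inner_sum_right inner_commute[of x] power2_eq_square mult.assoc)
    then show "0 \<le> x \<bullet> g x"
      by (simp add: sum_nonneg nn)
  qed
  ultimately show thesis using that by blast
qed

text \<open>If \<open>(S - T) e = l e\<close> then \<open>S\<^sup>2 - T\<^sup>2 = S (S - T) + (S - T) T\<close> gives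
  \<open>0 = l (e \<bullet> S e + e \<bullet> T e)\<close>, which forces \<open>l = 0\<close>.\<close>

lemma pos_semidef_sqrt_unique:
  fixes S T :: "real^'n^'n"
  assumes S: "pos_semidef S" and T: "pos_semidef T" and eq: "S ** S = T ** T"
  shows "S = T"
proof -
  have sa: "x \<bullet> ((S - T) *v y) = ((S - T) *v x) \<bullet> y" for x y
  proof -
    have "x \<bullet> (S *v y) = (S *v x) \<bullet> y" "x \<bullet> (T *v y) = (T *v x) \<bullet> y"
      using S T unfolding pos_semidef_def symmetric_matrix_iff by blast+
    then show ?thesis
      by (simp only: matrix_vector_mult_diff_rdistrib inner_diff_left inner_diff_right)
  qed
  obtain E where "finite E" "pairwise orthogonal E"
    and E: "\<And>e. e \<in> E \<Longrightarrow> norm e = 1"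
    "\<And>e. e \<in> E \<Longrightarrow> (S - T) *v e = (e \<bullet> ((S - T) *v e)) *\<^sub>R e" "span E = UNIV"
    by (rule self_adjoint_eigenbasis[OF matrix_vector_mul_linear sa]) blast
  have "(S - T) *v e = 0 *v e" if "e \<in> E" for e
  proof -
    define l where "l = e \<bullet> ((S - T) *v e)"
    have le: "S *v e - T *v e = l *\<^sub>R e"
      using E(2)[OF that] by (simp add: l_def matrix_vector_mult_diff_rdistrib)
    have "S *v (S *v e) = T *v (T *v e)"
      using eq by (simp add: matrix_vector_mul_assoc)
    then have "0 = e \<bullet> (S *v (S *v e - T *v e)) + e \<bullet> (S *v (T *v e) - T *v (T *v e))"
      by (simp add: matrix_vector_mult_diff_distrib inner_diff)
    also have "e \<bullet> (S *v (T *v e) - T *v (T *v e)) = ((S - T) *v e) \<bullet> (T *v e)"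
      by (metis matrix_vector_mult_diff_rdistrib sa)
    finally have "l * (e \<bullet> (S *v e) + e \<bullet> (T *v e)) = 0"
      using le by (simp add: matrix_vector_mult_diff_rdistrib matrix_vector_mult_scaleR algebra_simps)
    moreover have "0 \<le> e \<bullet> (S *v e)" "0 \<le> e \<bullet> (T *v e)"
      using S T by (auto simp: pos_semidef_def)
    \<comment> \<open>If the sum in brackets vanishes, so do both of its nonnegative terms, and
      \<open>l\<close> is their difference.\<close>
    ultimately have "l = 0"
      by (auto simp: l_def matrix_vector_mult_diff_rdistrib inner_diff add_nonneg_eq_0_iff)
    then show ?thesis
      using le by (simp add: matrix_vector_mult_diff_rdistrib)
  qed
  then have "(S - T) *v x = 0 *v x" for x
    using linear_eq_on_span[of "(*v) (S - T)" "(*v) 0" E x] E(3) by simp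
  then have "S - T = 0" by (simp add: matrix_eq)
  then show ?thesis by simp
qed

text \<open>Existence and uniqueness resolve the definite description in \<open>mat_sqrt\<close>;
  everything later about the root rests on these two facts.\<close>

lemma mat_sqrt_props:
  assumes "pos_semidef Q"
  shows pos_semidef_mat_sqrt: "pos_semidef (mat_sqrt Q)"
    and mat_sqrt_square: "mat_sqrt Q ** mat_sqrt Q = Q"
proof -
  have "\<exists>!S. pos_semidef S \<and> S ** S = Q"
    by (metis assms pos_semidef_sqrt_exists pos_semidef_sqrt_unique)
  from theI'[OF this] show "pos_semidef (mat_sqrt Q)" "mat_sqrt Q ** mat_sqrt Q = Q"
    unfolding mat_sqrt_def by auto
qed

section \<open>Traces and the weighted inner product\<close>

lemma trace_congruence_nonneg:
  fixes P Z :: "real^'n^'n"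
  assumes "\<And>x. 0 \<le> x \<bullet> (P *v x)"
  shows "0 \<le> trace (transpose Z ** P ** Z)"
proof -
  have "trace (transpose Z ** (P ** Z)) = (\<Sum>i\<in>UNIV. column i Z \<bullet> (P *v column i Z))"
    by (simp add: trace_def transpose_def matrix_matrix_mult_def matrix_vector_mult_def
        inner_vec_def column_def)
  then show ?thesis
    by (simp add: sum_nonneg assms matrix_mul_assoc)
qed

text \<open>Moving one factor of \<open>Q = H H\<close> around the trace gives the congruence
  \<open>H P H\<close>. The condition on \<open>P\<close> concerns its quadratic form, which is the
  information available about the bias \<open>E[X] - X0\<close>.\<close>

lemma trace_mult_nonneg:
  fixes P Q :: "real^'n^'n"
  assumes "\<And>x. 0 \<le> x \<bullet> (P *v x)" and "pos_semidef Q"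
  shows "0 \<le> trace (P ** Q)"
proof -
  let ?H = "mat_sqrt Q"
  have "trace (P ** Q) = trace ((P ** ?H) ** ?H)"
    by (simp add: assms(2) mat_sqrt_square flip: matrix_mul_assoc)
  also have "\<dots> = trace (transpose ?H ** P ** ?H)"
    using pos_semidef_mat_sqrt[OF assms(2)]
    by (simp add: trace_mul_sym[of _ ?H] pos_semidef_def matrix_mul_assoc)
  finally show ?thesis
    using trace_congruence_nonneg[OF assms(1), of ?H] by simp
qed

text \<open>Cyclicity of the trace joins the two roots into \<open>Q\<close>; from here on all
  computations are free of square roots.\<close>

lemma weighted_inner_eq_trace:
  assumes "pos_semidef Q"
  shows "weighted_inner P Q X Y = trace (transpose X ** P ** Y ** Q)"
proof -
  let ?H = "mat_sqrt Q" and ?Z = "transpose X ** P ** Y"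
  have "weighted_inner P Q X Y = trace (?H ** (?Z ** ?H))"
    by (simp add: weighted_inner_def matrix_mul_assoc)
  also have "\<dots> = trace (?Z ** (?H ** ?H))"
    by (subst trace_mul_sym) (simp add: matrix_mul_assoc)
  finally show ?thesis by (simp add: assms mat_sqrt_square)
qed

lemma pos_semidef_congruence:
  fixes P Z :: "real^'n^'n"
  assumes "pos_semidef P"
  shows "pos_semidef (transpose Z ** P ** Z)"
proof -
  have "x \<bullet> ((transpose Z ** P ** Z) *v x) = (Z *v x) \<bullet> (P *v (Z *v x))" for x
    by (metis dot_lmul_matrix matrix_vector_mul_assoc vector_transpose_matrix)
  moreover have "transpose (transpose Z ** P ** Z) = transpose Z ** P ** Z"
    using assms by (simp add: pos_semidef_def matrix_transpose_mul matrix_mul_assoc)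
  ultimately show ?thesis using assms by (simp add: pos_semidef_def)
qed

lemma weighted_norm_sq_nonneg:
  assumes "pos_semidef P" "pos_semidef Q"
  shows "0 \<le> weighted_norm_sq P Q X"
  using trace_mult_nonneg[of "transpose X ** P ** X" Q] pos_semidef_congruence[OF assms(1), of X] assms(2)
  by (simp add: weighted_norm_sq_def weighted_inner_eq_trace pos_semidef_def)

text \<open>Bilinear maps in finite dimension are bounded. The bounded form provides the
  integrability of products and lets a fixed slot commute with the expectation.\<close>

lemma bounded_bilinear_weighted_inner:
  fixes P Q :: "real^'n^'n"
  assumes "pos_semidef Q"
  shows "bounded_bilinear (weighted_inner P Q)"
proof -
  have "transpose (X + Y) = transpose X + transpose Y" for X Y :: "real^'n^'n"
    by (simp add: transpose_def vec_eq_iff)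
  moreover have "(X + Y) ** Z = X ** Z + Y ** Z" for X Y Z :: "real^'n^'n"
    by (simp add: matrix_matrix_mult_def vec_eq_iff sum.distrib distrib_right)
  moreover have "trace (c *\<^sub>R X) = c * trace X" for c and X :: "real^'n^'n"
    by (simp add: trace_def sum_distrib_left)
  ultimately have "bilinear (weighted_inner P Q)"
    unfolding bilinear_def
    by (auto intro!: linearI simp: weighted_inner_eq_trace[OF assms] transpose_scalar
        matrix_add_ldistrib trace_add matrix_scalar_ac simp flip: scalar_matrix_assoc)
  then show ?thesis
    by (simp add: bilinear_conv_bounded_bilinear)
qed

lemma weighted_inner_commute:
  assumes "transpose P = P" and "pos_semidef Q"
  shows "weighted_inner P Q X Y = weighted_inner P Q Y X"
proof -
  have tr: "trace (transpose Z) = trace Z" for Z :: "real^'n^'n"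
    by (simp add: trace_def transpose_def)
  have "trace (transpose X ** P ** Y ** Q) = trace (transpose (transpose X ** P ** Y ** Q))"
    by (simp add: tr)
  also have "\<dots> = trace (Q ** (transpose Y ** P ** X))"
    using assms by (simp add: matrix_transpose_mul pos_semidef_def matrix_mul_assoc)
  finally show ?thesis
    by (simp add: weighted_inner_eq_trace[OF assms(2)] trace_mul_sym[of Q])
qed

section \<open>Inverses of positive definite matrices\<close>

lemma pos_def_imp_pos_semidef: "pos_def P \<Longrightarrow> pos_semidef P"
  unfolding pos_def_def pos_semidef_def
  by (metis inner_zero_left less_imp_le order_refl)

lemma matrix_inv_inverse:
  fixes P :: "'a::semiring_1^'n^'m"
  assumes "invertible P"
  shows matrix_mul_matrix_inv: "P ** matrix_inv P = mat 1"
    and matrix_inv_matrix_mul: "matrix_inv P ** P = mat 1"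
  using someI_ex[OF assms[unfolded invertible_def]] by (auto simp: matrix_inv_def)

lemma pos_def_invertible:
  fixes P :: "real^'n^'n"
  assumes "pos_def P"
  shows "invertible P"
proof -
  have "\<forall>x. P *v x = 0 \<longrightarrow> x = 0"
    using assms unfolding pos_def_def by (metis inner_zero_right less_irrefl)
  then show ?thesis
    by (simp add: invertible_left_inverse matrix_left_invertible_ker)
qed

text \<open>Once the inverse \<open>V\<close> of \<open>P\<close> is known to be symmetric,
  \<open>V = V P V\<close> exhibits it as a congruence of \<open>P\<close>.\<close>

lemma pos_semidef_matrix_inv:
  fixes P :: "real^'n^'n"
  assumes "pos_def P"
  shows "pos_semidef (matrix_inv P)"
proof -
  note inv = matrix_inv_inverse[OF pos_def_invertible[OF assms]]
  have "transpose (matrix_inv P) ** P = mat 1"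
    using arg_cong[OF inv(1), of transpose] assms
    by (simp add: matrix_transpose_mul pos_def_def transpose_mat)
  then have "transpose (matrix_inv P) = matrix_inv P"
    by (metis inv(1) matrix_mul_assoc matrix_mul_lid matrix_mul_rid)
  moreover have "matrix_inv P = transpose (matrix_inv P) ** P ** matrix_inv P"
    by (simp add: \<open>transpose (matrix_inv P) ** P = mat 1\<close>)
  ultimately show ?thesis
    by (metis assms pos_def_imp_pos_semidef pos_semidef_congruence)
qed

text \<open>Equality holds at \<open>w = P\<inverse> v\<close>: the quadratic form of the inverse is a supremum of affine
  functions of \<open>P\<close>, which is the operator convexity of the inversion.\<close>

lemma pos_def_inverse_quadratic_form_ge:
  fixes P :: "real^'n^'n"
  assumes "pos_def P"
  shows "2 * (w \<bullet> v) - w \<bullet> (P *v w) \<le> v \<bullet> (matrix_inv P *v v)"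
proof -
  let ?u = "matrix_inv P *v v"
  have Pu: "P *v ?u = v"
    by (simp add: matrix_vector_mul_assoc matrix_mul_matrix_inv pos_def_invertible assms)
  \<comment> \<open>Completing the square: the gap between the two sides is exactly the form of
    \<open>P\<close> at \<open>w - ?u\<close>.\<close>
  have "0 \<le> (w - ?u) \<bullet> (P *v (w - ?u))"
    using pos_def_imp_pos_semidef[OF assms] by (simp add: pos_semidef_def)
  also have "\<dots> = w \<bullet> (P *v w) - w \<bullet> v - ?u \<bullet> (P *v w) + ?u \<bullet> v"
    by (simp add: matrix_vector_mult_diff_distrib Pu inner_diff_left inner_diff_right)
  also have "?u \<bullet> (P *v w) = v \<bullet> w"
    using assms Pu unfolding pos_def_def symmetric_matrix_iff by metis
  finally show ?thesis
    by (simp add: inner_commute algebra_simps)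
qed

text \<open>On a singular matrix \<open>matrix_inv\<close> is a choice from the empty predicate, hence the same
  constant for all of them; on the others it is given by Cramer's rule.\<close>

lemma borel_measurable_matrix_inv:
  "(matrix_inv :: real^'n^'n \<Rightarrow> real^'n^'n) \<in> borel_measurable borel"
proof -
  define N where "N = (SOME X :: real^'n^'n. False)"
  \<comment> \<open>Cramer's rule for \<open>P x = e_j\<close>, where the unit vector
    \<open>e_j\<close> is \<open>column j (mat 1)\<close> and replaces column \<open>k\<close> of
    \<open>P\<close>.\<close>
  define G :: "real^'n^'n \<Rightarrow> real^'n^'n" where
    "G P = (\<chi> k j. det (\<chi> i l. if l = k then column j (mat 1) $ i else P $ i $ l) / det P)" for P
  have "matrix_inv P = (if det P = 0 then N else G P)" for P :: "real^'n^'n"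
  proof (cases "det P = 0")
    case True
    then have "(\<lambda>X. P ** X = mat 1 \<and> X ** P = mat 1) = (\<lambda>X. False)"
      using invertible_det_nz[of P] by (auto simp: invertible_def)
    then show ?thesis using True unfolding matrix_inv_def N_def by simp
  next
    case False
    have "P *v column j (matrix_inv P) = column j (P ** matrix_inv P)" for j
      by (simp add: column_def matrix_vector_mult_def matrix_matrix_mult_def vec_eq_iff)
    then have "P *v column j (matrix_inv P) = column j (mat 1)" for j
      using False by (simp add: matrix_mul_matrix_inv invertible_det_nz)
    then have "column j (matrix_inv P) = column j (G P)" for j
      using False by (simp add: cramer) (subst column_def[of j "G P"], simp add: G_def)
    then show ?thesis
      using False by (simp add: column_def vec_eq_iff)
  qed
  then have eq: "matrix_inv = (\<lambda>P :: real^'n^'n. if det P = 0 then N else G P)" by auto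
  have entry: "(\<lambda>P::real^'n^'n. P $ i $ j) \<in> borel_measurable borel" for i j
    by (intro borel_measurable_continuous_onI continuous_intros)
  \<comment> \<open>A determinant is a finite sum of products of entries. This serves both the
    denominator \<open>det P\<close> and the numerators in \<open>G\<close>.\<close>
  have det: "(\<lambda>P. det (F P)) \<in> borel_measurable borel"
    if "\<And>i j. (\<lambda>P. F P $ i $ j) \<in> borel_measurable borel" for F :: "real^'n^'n \<Rightarrow> real^'n^'n"
    unfolding det_def using that by measurable
  have [measurable]: "(\<lambda>P::real^'n^'n. det P) \<in> borel_measurable borel"
    using entry by (rule det)
  have "(\<lambda>P. G P $ k $ j) \<in> borel_measurable borel" for k j
  proof -
    have "(\<lambda>P::real^'n^'n. det (\<chi> i l. if l = k then column j (mat 1) $ i else P $ i $ l))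
      \<in> borel_measurable borel"
      using entry by (intro det) simp
    then show ?thesis by (simp add: G_def)
  qed
  then have "G \<in> borel_measurable borel"
    by (subst borel_measurable_euclidean_space) (auto simp: Basis_vec_def inner_axis)
  then show ?thesis
    unfolding eq by measurable
qed

section \<open>Square-integrable random matrices\<close>

text \<open>The product is dominated by \<open>K * (norm U * norm V)\<close>, hence by a multiple of
  the sum of the squared norms. This covers the integrands of both errors, of the cross term and of
  the normalising constant.\<close>

lemma integrable_bounded_bilinear:
  fixes h :: "'a::euclidean_space \<Rightarrow> 'b::euclidean_space \<Rightarrow> 'c::euclidean_space"
  assumes "bounded_bilinear h"
    and U: "U \<in> borel_measurable M" "integrable M (\<lambda>x. (norm (U x))\<^sup>2)"
    and V: "V \<in> borel_measurable M" "integrable M (\<lambda>x. (norm (V x))\<^sup>2)"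
  shows "integrable M (\<lambda>x. h (U x) (V x))"
proof -
  interpret h: bounded_bilinear h by fact
  obtain K where K: "0 \<le> K" "\<And>a b. norm (h a b) \<le> norm a * norm b * K"
    using h.nonneg_bounded by blast
  have meas: "(\<lambda>x. h (U x) (V x)) \<in> borel_measurable M"
    using U(1) V(1)
    by (rule borel_measurable_continuous_Pair) (intro h.continuous_on continuous_intros)
  show ?thesis
  proof (rule Bochner_Integration.integrable_bound)
    show "integrable M (\<lambda>x. K * ((norm (U x))\<^sup>2 + (norm (V x))\<^sup>2))"
      using U V by simp
    show "AE x in M. norm (h (U x) (V x)) \<le> norm (K * ((norm (U x))\<^sup>2 + (norm (V x))\<^sup>2))"
    proof (rule AE_I2)
      fix x
      have "norm (U x) * norm (V x) \<le> (norm (U x))\<^sup>2 + (norm (V x))\<^sup>2"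
        using sum_squares_bound[of "norm (U x)" "norm (V x)"]
          mult_nonneg_nonneg[OF norm_ge_zero[of "U x"] norm_ge_zero[of "V x"]] by linarith
      then have "norm (U x) * norm (V x) * K \<le> K * ((norm (U x))\<^sup>2 + (norm (V x))\<^sup>2)"
        using K(1) by (simp add: mult.commute mult_left_mono)
      then show "norm (h (U x) (V x)) \<le> norm (K * ((norm (U x))\<^sup>2 + (norm (V x))\<^sup>2))"
        using K(2)[of "U x" "V x"] K(1) by simp
    qed
  qed (fact meas)
qed

text \<open>The norm of the matrix type is the Frobenius norm; this links the second moment of the
  inverse, given as a matrix, to square integrability.\<close>

lemma power2_norm_eq_trace: "(norm X)\<^sup>2 = trace (transpose X ** X)" for X :: "real^'n^'m"
  by (simp add: power2_norm_eq_inner inner_vec_def trace_def matrix_matrix_mult_def transpose_def)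
    (rule sum.swap)

lemma integrable_square_integrable:
  fixes U :: "'w \<Rightarrow> 'a::euclidean_space"
  assumes "finite_measure M" "U \<in> borel_measurable M" "integrable M (\<lambda>x. (norm (U x))\<^sup>2)"
  shows "integrable M U"
proof -
  interpret finite_measure M by fact
  show ?thesis
    \<comment> \<open>The constant \<open>1\<close> is square integrable on a finite measure space,
      and scaling \<open>U\<close> by it returns \<open>U\<close>.\<close>
    using integrable_bounded_bilinear[OF bounded_bilinear_scaleR, of "\<lambda>_. 1" M U] assms(2,3) by simp
qed

lemma integrable_norm_sq_diff:
  fixes U V :: "'w \<Rightarrow> 'a::euclidean_space"
  assumes U: "U \<in> borel_measurable M" "integrable M (\<lambda>x. (norm (U x))\<^sup>2)"
    and V: "V \<in> borel_measurable M" "integrable M (\<lambda>x. (norm (V x))\<^sup>2)"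
  shows "integrable M (\<lambda>x. (norm (U x - V x))\<^sup>2)"
proof -
  note ip = integrable_bounded_bilinear[OF bounded_bilinear_inner]
  have "(norm (U x - V x))\<^sup>2 = U x \<bullet> U x - 2 * (U x \<bullet> V x) + V x \<bullet> V x" for x
    by (simp add: power2_norm_eq_inner inner_diff_left inner_diff_right inner_commute)
  then show ?thesis
    by (simp add: ip[OF U U] ip[OF U V] ip[OF V V])
qed

text \<open>The affine lower bound for \<open>Y\<inverse>\<close> is integrated at the point \<open>w = A\<inverse> v\<close>, which
  avoids passing through the inverse of \<open>E[Y]\<close>.\<close>

lemma (in prob_space) matrix_inv_expectation_ge:
  fixes Y :: "'a \<Rightarrow> real^'n^'n"
  assumes A: "pos_def A" and pd: "AE \<omega> in M. pos_def (Y \<omega>)"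
    and Y: "integrable M Y" and inv: "integrable M (\<lambda>\<omega>. matrix_inv (Y \<omega>))"
    and le: "loewner_le (expectation Y) A"
  shows "0 \<le> v \<bullet> ((expectation (\<lambda>\<omega>. matrix_inv (Y \<omega>)) - matrix_inv A) *v v)"
proof -
  define w where "w = matrix_inv A *v v"
  have Aw: "A *v w = v"
    by (simp add: w_def matrix_vector_mul_assoc matrix_mul_matrix_inv pos_def_invertible A)
  have bl: "bounded_linear (\<lambda>X::real^'n^'n. x \<bullet> (X *v x))" for x
    unfolding linear_conv_bounded_linear[symmetric]
    by (auto intro!: linearI simp: matrix_vector_mult_add_rdistrib inner_add_right
        scaleR_matrix_vector_assoc[symmetric])
  note intY = integrable_bounded_linear[OF bl Y] and intI = integrable_bounded_linear[OF bl inv]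
  \<comment> \<open>As \<open>A w = v\<close>, the right side is \<open>w \<bullet> v\<close>, which
    is also the quadratic form of the inverse of \<open>A\<close> at \<open>v\<close>; the Loewner
    bound is used here.\<close>
  have "w \<bullet> (expectation Y *v w) \<le> w \<bullet> (A *v w)"
    using le by (simp add: loewner_le_def pos_semidef_def matrix_vector_mult_diff_rdistrib inner_diff_right)
  then have "w \<bullet> v \<le> 2 * (w \<bullet> v) - w \<bullet> (expectation Y *v w)"
    by (simp add: Aw)
  also have "\<dots> = expectation (\<lambda>\<omega>. 2 * (w \<bullet> v) - w \<bullet> (Y \<omega> *v w))"
    using integral_bounded_linear[OF bl Y, of w] intY by (simp add: prob_space)
  also have "\<dots> \<le> expectation (\<lambda>\<omega>. v \<bullet> (matrix_inv (Y \<omega>) *v v))"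
    by (rule integral_mono_AE)
      (use intY intI pd in \<open>auto elim!: eventually_mono intro: pos_def_inverse_quadratic_form_ge\<close>)
  also have "\<dots> = v \<bullet> (expectation (\<lambda>\<omega>. matrix_inv (Y \<omega>)) *v v)"
    by (rule integral_bounded_linear[OF bl inv])
  finally show ?thesis
    by (simp add: matrix_vector_mult_diff_rdistrib inner_diff_right w_def inner_commute)
qed

section \<open>The error parabola and the bounds on its minimiser\<close>

text \<open>By completing the square. The equivalence gives existence and uniqueness of the
  minimiser, so that the optimal \<open>\<beta>\<close> is well defined.\<close>

lemma quadratic_minimum:
  fixes err :: "real \<Rightarrow> real"
  assumes err: "\<And>\<beta>. err \<beta> = e0 - 2 * \<beta> * a + \<beta>\<^sup>2 * N" and "0 < N"
  shows "is_arg_min err (\<lambda>_. True) \<beta> \<longleftrightarrow> \<beta> = a / N" and "err (a / N) = e0 - a\<^sup>2 / N"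
proof -
  have sq: "err \<beta> = err (a / N) + N * (\<beta> - a / N)\<^sup>2" for \<beta>
    using \<open>0 < N\<close> by (simp add: err field_simps power2_eq_square)
  show "is_arg_min err (\<lambda>_. True) \<beta> \<longleftrightarrow> \<beta> = a / N"
  proof
    assume "is_arg_min err (\<lambda>_. True) \<beta>"
    then have "N * (\<beta> - a / N)\<^sup>2 \<le> 0"
      using sq[of \<beta>] by (simp add: is_arg_min_linorder) (metis add_le_same_cancel1)
    then show "\<beta> = a / N"
      using \<open>0 < N\<close> by (simp add: mult_le_0_iff)
  next
    assume "\<beta> = a / N"
    moreover have "err (a / N) \<le> err x" for x
      using sq[of x] \<open>0 < N\<close> by simp
    ultimately show "is_arg_min err (\<lambda>_. True) \<beta>"
      by (simp add: is_arg_min_linorder)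
  qed
  show "err (a / N) = e0 - a\<^sup>2 / N"
    using \<open>0 < N\<close> by (simp add: err field_simps power2_eq_square)
qed

theorem theorem5p1:
  fixes M :: "'w measure"
    and A B C D R :: "real^'n^'n"
    and Ahat :: "'w \<Rightarrow> real^'n^'n"
  assumes "prob_space M"
    and "pos_def A"
    and "Ahat \<in> borel_measurable M"
    and "AE \<omega> in M. pos_def (Ahat \<omega>)"
    and "integrable M Ahat"
    and "(\<integral>\<omega>. Ahat \<omega> \<partial>M) \<preceq>\<^sub>L A"
    and "integrable M (\<lambda>\<omega>. matrix_inv (Ahat \<omega>) ** matrix_inv (Ahat \<omega>))"
    and "pos_def B"
    and "pos_semidef R"
    and "R ** transpose D = transpose C ** B"
    and "R ** transpose D = transpose (R ** transpose D)"
    and "pos_semidef (R ** transpose D)"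
    and "(\<integral>\<omega>. weighted_norm_sq (transpose C ** B ** C) (D ** R ** transpose D)
                  (matrix_inv (Ahat \<omega>)) \<partial>M) > 0"
  shows "let Ainv = (\<lambda>\<omega>. matrix_inv (Ahat \<omega>));
             Khat = (\<lambda>\<omega>. C ** matrix_inv (Ahat \<omega>) ** D);
             err = (\<lambda>\<beta>::real. mean_sq_error M A B R (\<lambda>\<omega>. Ainv \<omega> - \<beta> *\<^sub>R Khat \<omega>));
             err0 = mean_sq_error M A B R Ainv;
             err1 = mean_sq_error M A (transpose C ** B) (R ** transpose D) Ainv;
             N = (\<integral>\<omega>. weighted_norm_sq (transpose C ** B ** C) (D ** R ** transpose D)
                        (Ainv \<omega>) \<partial>M)
         in (\<exists>\<beta>s. (\<forall>\<beta>. is_arg_min err (\<lambda>_. True) \<beta> \<longleftrightarrow> \<beta> = \<beta>s)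
                 \<and> sqrt (err0 / N) \<ge> \<beta>s \<and> \<beta>s \<ge> err1 / N \<and> err1 / N \<ge> 0)
            \<and> (err0 > 0 \<longrightarrow>
                 (\<exists>\<beta>m. is_arg_max (\<lambda>\<beta>. (err0 - err \<beta>) / err0) (\<lambda>_. True) \<beta>m
                      \<and> (err0 - err \<beta>m) / err0 \<ge> err1\<^sup>2 / (N * err0)))"
proof -
  interpret prob_space M by fact
  define S where "S = R ** transpose D"
  define X where "X = (\<lambda>\<omega>. matrix_inv (Ahat \<omega>))"
  define X0 where "X0 = matrix_inv A"
  define K where "K \<omega> = C ** X \<omega> ** D" for \<omega>
  define e0 where "e0 = mean_sq_error M A B R X"
  define e1 where "e1 = mean_sq_error M A S S X"
  define err where "err = (\<lambda>\<beta>::real. mean_sq_error M A B R (\<lambda>\<omega>. X \<omega> - \<beta> *\<^sub>R K \<omega>))"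
  define N where "N = (\<integral>\<omega>. weighted_norm_sq (transpose C ** B ** C) (D ** R ** transpose D) (X \<omega>) \<partial>M)"
  define a where "a = (\<integral>\<omega>. weighted_inner B R (X \<omega> - X0) (K \<omega>) \<partial>M)"
  note R = \<open>pos_semidef R\<close>
  have S: "pos_semidef S" and CB: "transpose C ** B = S" and symS: "transpose S = S"
    using assms by (simp_all add: S_def)
  have B: "pos_semidef B"
    using assms(8) by (rule pos_def_imp_pos_semidef)
  with R have symR: "transpose R = R" and symB: "transpose B = B"
    by (simp_all add: pos_semidef_def)
  \<comment> \<open>Transposes of \<open>transpose C ** B = S\<close> and
    \<open>S = R ** transpose D\<close>, in which \<open>B\<close>, \<open>R\<close> and
    \<open>S\<close> are symmetric.\<close>
  have BC: "B ** C = S" and DR: "D ** R = S"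
    using arg_cong[OF CB, of transpose] arg_cong[OF S_def, of transpose]
    by (simp_all add: matrix_transpose_mul symS symB symR)
  have DRD: "pos_semidef (D ** R ** transpose D)"
    using pos_semidef_congruence[OF R, of "transpose D"] by simp
  have "N > 0" using assms(13) by (simp add: N_def X_def)

  have X_meas: "X \<in> borel_measurable M"
    unfolding X_def using assms(3) borel_measurable_matrix_inv by (rule measurable_compose)
  have "linear (trace :: real^'n^'n \<Rightarrow> real)"
    by (intro linearI trace_add) (simp add: trace_def sum_distrib_left)
  then have "integrable M (\<lambda>\<omega>. trace (X \<omega> ** X \<omega>))"
    using assms(7) unfolding X_def linear_conv_bounded_linear by (rule integrable_bounded_linear)
  \<comment> \<open>The inverse is almost surely symmetric, so the trace of its square is its
    squared Frobenius norm.\<close>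
  moreover have "AE \<omega> in M. trace (X \<omega> ** X \<omega>) = (norm (X \<omega>))\<^sup>2"
    using assms(4)
  proof eventually_elim
    case (elim \<omega>)
    then have "transpose (X \<omega>) = X \<omega>"
      unfolding X_def using pos_semidef_matrix_inv pos_semidef_def by blast
    then show ?case by (simp add: power2_norm_eq_trace)
  qed
  ultimately have X_sq: "integrable M (\<lambda>\<omega>. (norm (X \<omega>))\<^sup>2)"
    using X_meas by (elim integrable_cong_AE_imp) simp_all
  have X_int: "integrable M X"
    by (rule integrable_square_integrable[OF finite_measure_axioms X_meas X_sq])
  have E_meas: "(\<lambda>\<omega>. X \<omega> - X0) \<in> borel_measurable M"
    using X_meas by simp
  have E_sq: "integrable M (\<lambda>\<omega>. (norm (X \<omega> - X0))\<^sup>2)"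
    by (rule integrable_norm_sq_diff[OF X_meas X_sq]) simp_all

  have EK: "weighted_inner B R (Y - X0) (C ** Y ** D) = weighted_inner S S (Y - X0) Y" for Y
  proof -
    have "transpose (Y - X0) ** B ** (C ** Y ** D) ** R = transpose (Y - X0) ** (B ** C) ** Y ** (D ** R)"
      by (simp add: matrix_mul_assoc)
    then show ?thesis by (simp add: weighted_inner_eq_trace R S BC DR)
  qed
  have KK: "weighted_inner B R (C ** Y ** D) (C ** Y ** D)
      = weighted_norm_sq (transpose C ** B ** C) (D ** R ** transpose D) Y" for Y
  proof -
    have "trace (transpose (C ** Y ** D) ** B ** (C ** Y ** D) ** R)
        = trace (transpose D ** (transpose Y ** transpose C ** B ** C ** Y ** D ** R))"
      by (simp add: matrix_transpose_mul matrix_mul_assoc)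
    also have "\<dots> = trace (transpose Y ** transpose C ** B ** C ** Y ** D ** R ** transpose D)"
      by (rule trace_mul_sym)
    finally show ?thesis
      by (simp add: weighted_norm_sq_def weighted_inner_eq_trace R DRD matrix_mul_assoc)
  qed

  interpret BR: bounded_bilinear "weighted_inner B R"
    using R by (rule bounded_bilinear_weighted_inner)
  interpret SS: bounded_bilinear "weighted_inner S S"
    using S by (rule bounded_bilinear_weighted_inner)
  interpret KK: bounded_bilinear "weighted_inner (transpose C ** B ** C) (D ** R ** transpose D)"
    using DRD by (rule bounded_bilinear_weighted_inner)
  \<comment> \<open>In order, the integrands of \<open>e0\<close>, of \<open>a\<close> (in the form
    given by \<open>EK\<close>), of \<open>e1\<close> and of \<open>N\<close>.\<close>
  note int = integrable_bounded_bilinear[OF BR.bounded_bilinear_axioms E_meas E_sq E_meas E_sq]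
    integrable_bounded_bilinear[OF SS.bounded_bilinear_axioms E_meas E_sq X_meas X_sq]
    integrable_bounded_bilinear[OF SS.bounded_bilinear_axioms E_meas E_sq E_meas E_sq]
    integrable_bounded_bilinear[OF KK.bounded_bilinear_axioms X_meas X_sq X_meas X_sq]

  have quad: "err \<beta> = e0 - 2 * \<beta> * a + \<beta>\<^sup>2 * N" for \<beta>
  proof -
    have "weighted_norm_sq B R (X \<omega> - \<beta> *\<^sub>R K \<omega> - X0)
        = weighted_inner B R (X \<omega> - X0) (X \<omega> - X0) - 2 * \<beta> * weighted_inner S S (X \<omega> - X0) (X \<omega>)
          + \<beta>\<^sup>2 * weighted_norm_sq (transpose C ** B ** C) (D ** R ** transpose D) (X \<omega>)" for \<omega>
    proof -
      have "weighted_inner B R (U - \<beta> *\<^sub>R V) (U - \<beta> *\<^sub>R V) = weighted_inner B R U U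
          - 2 * \<beta> * weighted_inner B R U V + \<beta>\<^sup>2 * weighted_inner B R V V" for U V
        by (simp add: BR.diff_left BR.diff_right BR.scaleR_left BR.scaleR_right
            weighted_inner_commute[OF symB R, of V U] power2_eq_square algebra_simps)
      moreover have "X \<omega> - \<beta> *\<^sub>R K \<omega> - X0 = X \<omega> - X0 - \<beta> *\<^sub>R K \<omega>"
        by simp
      ultimately show ?thesis
        by (simp only: weighted_norm_sq_def[of B] K_def EK KK)
    qed
    then have "err \<beta> = (\<integral>\<omega>. weighted_inner B R (X \<omega> - X0) (X \<omega> - X0)
        - 2 * \<beta> * weighted_inner S S (X \<omega> - X0) (X \<omega>)
        + \<beta>\<^sup>2 * weighted_norm_sq (transpose C ** B ** C) (D ** R ** transpose D) (X \<omega>) \<partial>M)"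
      by (simp only: err_def mean_sq_error_def X0_def)
    also have "\<dots> = e0 - 2 * \<beta> * a + \<beta>\<^sup>2 * N"
      unfolding e0_def a_def N_def mean_sq_error_def K_def EK weighted_norm_sq_def X0_def[symmetric]
      by (simp only: Bochner_Integration.integral_add Bochner_Integration.integral_diff
          Bochner_Integration.integrable_diff integrable_mult_right integral_mult_right_zero int)
    finally show ?thesis .
  qed

  have E_int: "integrable M (\<lambda>\<omega>. X \<omega> - X0)"
    using X_int by simp
  note SS_X0 = SS.bounded_linear_left[of X0]
  \<comment> \<open>Writing the right argument as \<open>X = (X - X0) + X0\<close> splits off
    \<open>e1\<close>; the remainder is linear in \<open>X - X0\<close>, so the expectation moves
    inside.\<close>
  have "a = e1 + (\<integral>\<omega>. weighted_inner S S (X \<omega> - X0) X0 \<partial>M)"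
  proof -
    have "integrable M (\<lambda>\<omega>. weighted_inner S S (X \<omega> - X0) X0)"
      by (rule integrable_bounded_linear[OF SS_X0 E_int])
    then have "e1 + (\<integral>\<omega>. weighted_inner S S (X \<omega> - X0) X0 \<partial>M)
        = (\<integral>\<omega>. weighted_inner S S (X \<omega> - X0) (X \<omega> - X0) + weighted_inner S S (X \<omega> - X0) X0 \<partial>M)"
      unfolding e1_def mean_sq_error_def weighted_norm_sq_def X0_def[symmetric]
      by (rule Bochner_Integration.integral_add[OF int(3), symmetric])
    also have "\<dots> = a"
      by (simp add: a_def K_def EK flip: SS.add_right)
    finally show ?thesis ..
  qed
  also have "(\<integral>\<omega>. weighted_inner S S (X \<omega> - X0) X0 \<partial>M)
      = weighted_inner S S (expectation X - X0) X0"
    using integral_bounded_linear[OF SS_X0 E_int] X_int by (simp add: prob_space)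
  finally have a_eq: "a = e1 + weighted_inner S S (expectation X - X0) X0" .
  have "0 \<le> weighted_inner S S (expectation X - X0) X0"
  proof -
    let ?G = "transpose (expectation X - X0)"
    \<comment> \<open>The weighted product transposes its left argument, and transposition preserves
      the quadratic form.\<close>
    have "x \<bullet> (?G *v x) = x \<bullet> ((expectation X - X0) *v x)" for x
      by (simp only: transpose_matrix_vector inner_commute[of _ "x v* _"] dot_lmul_matrix)
    then have "0 \<le> x \<bullet> (?G *v x)" for x
      using matrix_inv_expectation_ge[OF assms(2,4,5) X_int[unfolded X_def] assms(6)]
      by (simp only: X_def X0_def)
    moreover have "pos_semidef (S ** X0 ** S)"
      using pos_semidef_congruence[OF pos_semidef_matrix_inv[OF assms(2)], of S] by (simp add: symS X0_def)
    ultimately have "0 \<le> trace (?G ** (S ** X0 ** S))"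
      by (rule trace_mult_nonneg)
    then show ?thesis
      by (simp add: weighted_inner_eq_trace S matrix_mul_assoc)
  qed
  then have "e1 \<le> a" by (simp add: a_eq)
  have "0 \<le> e1"
    by (simp add: e1_def mean_sq_error_def weighted_norm_sq_nonneg S)
  have "0 \<le> err (a / N)"
    by (simp add: err_def mean_sq_error_def weighted_norm_sq_nonneg B R)

  note min = quadratic_minimum[OF quad \<open>N > 0\<close>]
  \<comment> \<open>The minimal error \<open>e0 - a\<^sup>2 / N\<close> is nonnegative; divide by
    \<open>N\<close>.\<close>
  have "(a / N)\<^sup>2 \<le> e0 / N"
    using \<open>0 \<le> err (a / N)\<close> \<open>N > 0\<close> by (simp add: min(2) field_simps power2_eq_square)
  then have "a / N \<le> sqrt (e0 / N)"
    by (rule real_le_rsqrt)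
  moreover have "e1 / N \<le> a / N" "0 \<le> e1 / N"
    using \<open>e1 \<le> a\<close> \<open>0 \<le> e1\<close> \<open>N > 0\<close> by (simp_all add: divide_right_mono)
  \<comment> \<open>The relative improvement is a decreasing affine function of the error, so it is
    greatest where the error is least, with value \<open>a\<^sup>2 / (N * e0)\<close>.\<close>
  moreover have "is_arg_max (\<lambda>\<beta>. (e0 - err \<beta>) / e0) (\<lambda>_. True) (a / N)" if "e0 > 0"
    using min(1)[of "a / N"] that
    by (simp add: is_arg_max_linorder is_arg_min_linorder divide_right_mono)
  moreover have "e1\<^sup>2 / (N * e0) \<le> (e0 - err (a / N)) / e0" if "e0 > 0"
    using power_mono[OF \<open>e1 \<le> a\<close> \<open>0 \<le> e1\<close>, of 2] that \<open>N > 0\<close>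
    by (simp add: min(2) divide_right_mono)
  ultimately have "(\<exists>\<beta>s. (\<forall>\<beta>. is_arg_min err (\<lambda>_. True) \<beta> \<longleftrightarrow> \<beta> = \<beta>s)
        \<and> sqrt (e0 / N) \<ge> \<beta>s \<and> \<beta>s \<ge> e1 / N \<and> e1 / N \<ge> 0)
      \<and> (e0 > 0 \<longrightarrow> (\<exists>\<beta>m. is_arg_max (\<lambda>\<beta>. (e0 - err \<beta>) / e0) (\<lambda>_. True) \<beta>m
          \<and> (e0 - err \<beta>m) / e0 \<ge> e1\<^sup>2 / (N * e0)))"
    using min(1) by blast
  then show ?thesis
    unfolding Let_def CB err_def e0_def e1_def N_def K_def X_def S_def[symmetric] .
qed

end
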